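(* Let $S = \langle m, n_2,\ldots,n_k\rangle$ be a numerical semigroup, suppose $T = \langle\alpha\rangle+\beta S$ is a monoscopic gluing of $S$, and fix $b\alpha+a\beta,\ b'\alpha+a'\beta\in\operatorname{Ap}(T;\beta m)$, where $a,a'\in\operatorname{Ap}(S;m)$ and $0\le b,b'\le\beta-1$. (a) If $\alpha\notin\operatorname{Ap}(S;m)$, then $b\alpha+a\beta\preceq_T b'\alpha+a'\beta$ if and only if $a\preceq_S a'$ and $b\le b'$. (b) If $\alpha\in\operatorname{Ap}(S;m)$, then $b\alpha+a\beta\preceq_T b'\alpha+a'\beta$ if and only if $a\preceq_S a'$ and either $b\le b'$ or $\alpha\preceq_S a'-a$.
   Context: A numerical semigroup is a subset $S \subseteq \mathbb{Z}_{\ge 0}$ containing $0$, closed under addition, with finite complement; $\langle n_1,\ldots,n_k\rangle$ denotes the set of all non-negative integer combinations of $n_1,\ldots,n_k$. For $m \in S$, $m>0$, the Apéry set is $\operatorname{Ap}(S;m) = \{n \in S : n-m\notin S\}$. For a numerical semigroup $S$, $x\preceq_S y$ means $y-x\in S$. Monoscopic gluing: given a numerical semigroup $S=\langle n_1,\ldots,n_k\rangle$, an integer $\beta\ge 2$, and an element $\alpha\in S\setminus\{n_1,\ldots,n_k\}$ with $\gcd(\alpha,\beta)=1$, the numerical semigroup $T=\langle\alpha\rangle+\beta S=\langle\alpha,\beta n_1,\ldots,\beta n_k\rangle$ is called a monoscopic gluing of $S$ (here $n_1=m$). It is known that $\operatorname{Ap}(T;\beta m)=\{b\alpha+a\beta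 : a\in\operatorname{Ap}(S;m),\ 0\le b\le\beta-1\}$, and each element has a unique such expression. *)

theory Defs
  imports Main "HOL-Library.Set_Algebras"
begin

text \<open>
  Semigroups are sets of integers contained in the non-negative integers, so that the differences
  in the Apery set and in the divisibility order are true (not truncated) differences.
\<close>

definition numerical_semigroup :: "int set \<Rightarrow> bool" where
  "numerical_semigroup S \<longleftrightarrow>
     S \<subseteq> {0..} \<and> 0 \<in> S \<and> (\<forall>x\<in>S. \<forall>y\<in>S. x + y \<in> S) \<and> finite ({0..} - S)"

definition generated :: "int list \<Rightarrow> int set" where
  "generated ns = {\<Sum>i<length ns. int (c i) * ns ! i | c :: nat \<Rightarrow> nat. True}"

text \<open>Only meaningful for \<open>m \<in> S\<close> with \<open>m > 0\<close>.\<close>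

definition Apery :: "int set \<Rightarrow> int \<Rightarrow> int set" where
  "Apery S m = {n \<in> S. n - m \<notin> S}"

definition semigroup_le :: "int \<Rightarrow> int set \<Rightarrow> int \<Rightarrow> bool"
    ("(_ \<preceq>\<^bsub>_\<^esub> _)" [51, 0, 51] 50) where
  "x \<preceq>\<^bsub>S\<^esub> y \<longleftrightarrow> y - x \<in> S"

text \<open>
  The list \<open>ns\<close> of generators is a parameter because \<open>\<alpha>\<close> has to avoid the given generators.
  In the last conjunct, \<open>+\<close> is the sumset and \<open>\<beta> *o S\<close> the dilation \<open>\<beta> S\<close>
  of \<^theory>\<open>HOL-Library.Set_Algebras\<close>.
\<close>

definition monoscopic_gluing :: "int set \<Rightarrow> int \<Rightarrow> int \<Rightarrow> int list \<Rightarrow> bool" where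
  "monoscopic_gluing T \<alpha> \<beta> ns \<longleftrightarrow>
     numerical_semigroup (generated ns) \<and> \<beta> \<ge> 2 \<and>
     \<alpha> \<in> generated ns - set ns \<and> gcd \<alpha> \<beta> = 1 \<and>
     T = generated [\<alpha>] + \<beta> *o generated ns"

end

theory Submission imports Defs begin

text \<open>
  The difference of the two elements is \<open>(b' - b) \<alpha> + (a' - a) \<beta>\<close>. Since \<open>\<alpha> \<in> S\<close>, any \<open>\<beta>\<close> copies
  of \<open>\<alpha>\<close> can be absorbed into \<open>\<beta> S\<close>, and by coprimality this is the only ambiguity, so
  \<open>c \<alpha> + d \<beta> \<in> T\<close> iff \<open>d + (c div \<beta>) \<alpha> \<in> S\<close>. For \<open>c = b' - b\<close> the quotient is \<open>0\<close> or \<open>-1\<close>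
  according to whether \<open>b \<le> b'\<close>. In the second case \<open>a' - a - \<alpha> \<in> S\<close>, which is incompatible with
  \<open>\<alpha> - m \<in> S\<close> because \<open>a' - m \<notin> S\<close>.
\<close>

lemma generated_singleton: "generated [x] = {int k * x | k. True}"
  by (auto simp: generated_def)

lemma numerical_semigroup_add:
  "numerical_semigroup S \<Longrightarrow> x \<in> S \<Longrightarrow> y \<in> S \<Longrightarrow> x + y \<in> S"
  by (simp add: numerical_semigroup_def)

lemma numerical_semigroup_mult:
  assumes "numerical_semigroup S" and "x \<in> S" and "k \<ge> 0"
  shows "k * x \<in> S"
proof -
  have "int n * x \<in> S" for n
  proof (induction n)
    case 0
    then show ?case using assms(1) by (simp add: numerical_semigroup_def)
  next
    case (Suc n)
    then show ?case
      using numerical_semigroup_add[OF assms(1) assms(2) Suc.IH] by (simp add: algebra_simps)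
  qed
  from this[of "nat k"] show ?thesis using assms(3) by simp
qed

text \<open>Among all ways to write the integer with a non-negative coefficient of
  \<open>\<alpha>\<close>, the remainder \<open>c mod \<beta>\<close> is the smallest such
  coefficient, hence leaves the most \<open>\<alpha>\<close>s in the \<open>\<beta> *o S\<close>
  part. Here \<open>c\<close> may be negative, so \<open>div\<close> rounds down.\<close>

lemma gluing_mem_iff:
  assumes S: "numerical_semigroup S" and \<alpha>: "\<alpha> \<in> S" and \<beta>: "\<beta> > 0" and cop: "coprime \<alpha> \<beta>"
  shows "c * \<alpha> + d * \<beta> \<in> generated [\<alpha>] + \<beta> *o S \<longleftrightarrow> d + (c div \<beta>) * \<alpha> \<in> S"
proof
  assume "c * \<alpha> + d * \<beta> \<in> generated [\<alpha>] + \<beta> *o S"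
  then obtain k s where s: "s \<in> S" and eq: "c * \<alpha> + d * \<beta> = int k * \<alpha> + \<beta> * s"
    by (auto simp: generated_singleton set_plus_def elt_set_times_def)
  then have eq': "(c - int k) * \<alpha> = \<beta> * (s - d)"
    by (simp add: algebra_simps)
  then have "\<beta> dvd c - int k"
    using cop by (metis coprime_commute coprime_dvd_mult_left_iff dvd_triv_left)
  then obtain q where q: "c - int k = \<beta> * q" by blast
  with eq' \<beta> have "q * \<alpha> = s - d" by simp
  \<comment> \<open>It remains to see that the multiplier of \<open>\<alpha>\<close> is
    non-negative, which comes from \<open>k\<close> being a natural number.\<close>
  then have "d + (c div \<beta>) * \<alpha> = s + (c div \<beta> - q) * \<alpha>"
    by (simp add: algebra_simps)
  moreover have "q \<le> c div \<beta>"
  proof -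
    have "\<beta> * q \<le> c" using q by simp
    from zdiv_mono1[OF this \<beta>] show ?thesis using \<beta> by simp
  qed
  ultimately show "d + (c div \<beta>) * \<alpha> \<in> S"
    using numerical_semigroup_add[OF S s] numerical_semigroup_mult[OF S \<alpha>] by simp
next
  assume "d + (c div \<beta>) * \<alpha> \<in> S"
  \<comment> \<open>The conversion by \<open>nat\<close> loses nothing, since
    \<open>\<beta> > 0\<close> makes the remainder non-negative.\<close>
  moreover have "c * \<alpha> + d * \<beta> = int (nat (c mod \<beta>)) * \<alpha> + \<beta> * (d + (c div \<beta>) * \<alpha>)"
  proof -
    have "c * \<alpha> = \<beta> * (c div \<beta>) * \<alpha> + (c mod \<beta>) * \<alpha>"
      by (simp flip: distrib_right)
    then show ?thesis using \<beta> by (simp add: distrib_left)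
  qed
  ultimately show "c * \<alpha> + d * \<beta> \<in> generated [\<alpha>] + \<beta> *o S"
    unfolding generated_singleton set_plus_def elt_set_times_def by blast
qed

theorem theorem5p4:
  fixes S T :: "int set" and m \<alpha> \<beta> a a' b b' :: int and ns :: "int list"
  assumes "numerical_semigroup S" and "S = generated (m # ns)" and "m > 0"
    and "monoscopic_gluing T \<alpha> \<beta> (m # ns)"
    and "a \<in> Apery S m" and "a' \<in> Apery S m"
    and "0 \<le> b" and "b \<le> \<beta> - 1" and "0 \<le> b'" and "b' \<le> \<beta> - 1"
    and "b * \<alpha> + a * \<beta> \<in> Apery T (\<beta> * m)" and "b' * \<alpha> + a' * \<beta> \<in> Apery T (\<beta> * m)"
  shows "(\<alpha> \<notin> Apery S m \<longrightarrow>
            (b * \<alpha> + a * \<beta> \<preceq>\<^bsub>T\<^esub> b' * \<alpha> + a' * \<beta> \<longleftrightarrow> a \<preceq>\<^bsub>S\<^esub> a' \<and> b \<le> b'))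
       \<and> (\<alpha> \<in> Apery S m \<longrightarrow>
            (b * \<alpha> + a * \<beta> \<preceq>\<^bsub>T\<^esub> b' * \<alpha> + a' * \<beta> \<longleftrightarrow>
               a \<preceq>\<^bsub>S\<^esub> a' \<and> (b \<le> b' \<or> \<alpha> \<preceq>\<^bsub>S\<^esub> a' - a)))"
proof -
  have S: "numerical_semigroup S" and \<alpha>: "\<alpha> \<in> S" and \<beta>: "\<beta> > 0" and cop: "coprime \<alpha> \<beta>"
    and T: "T = generated [\<alpha>] + \<beta> *o S"
    using assms(2,4) by (auto simp: monoscopic_gluing_def coprime_iff_gcd_eq_1)
  have "b' * \<alpha> + a' * \<beta> - (b * \<alpha> + a * \<beta>) = (b' - b) * \<alpha> + (a' - a) * \<beta>"
    by (simp add: algebra_simps)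
  then have le_iff: "b * \<alpha> + a * \<beta> \<preceq>\<^bsub>T\<^esub> b' * \<alpha> + a' * \<beta> \<longleftrightarrow>
      a' - a + ((b' - b) div \<beta>) * \<alpha> \<in> S"
    using gluing_mem_iff[OF S \<alpha> \<beta> cop] by (simp add: semigroup_le_def T)
  show ?thesis
  proof (cases "b \<le> b'")
    case True
    then have "(b' - b) div \<beta> = 0" using assms(7-10) by (simp add: div_pos_pos_trivial)
    with True le_iff show ?thesis by (simp add: semigroup_le_def)
  next
    case False
    \<comment> \<open>Both \<open>b\<close> and \<open>b'\<close> lie in a range of length
      \<open>\<beta>\<close>, so adding \<open>\<beta>\<close> once to the negative difference gives
      a valid remainder.\<close>
    then have "(b' - b) div \<beta> = -1" 
      using assms(7-10) by (intro int_div_pos_eq[where r = "b' - b + \<beta>"]) auto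
    with le_iff have le_iff': "b * \<alpha> + a * \<beta> \<preceq>\<^bsub>T\<^esub> b' * \<alpha> + a' * \<beta> \<longleftrightarrow> a' - a - \<alpha> \<in> S"
      by simp
    have "a \<in> S" and a': "a' - m \<notin> S" using assms(5,6) by (auto simp: Apery_def)
    have "a' - a \<in> S" if "a' - a - \<alpha> \<in> S"
      using numerical_semigroup_add[OF S that \<alpha>] by simp
    moreover have "\<alpha> \<in> Apery S m" if "a' - a - \<alpha> \<in> S"
    proof (rule ccontr)
      assume "\<alpha> \<notin> Apery S m"
      then have "\<alpha> - m \<in> S" using \<alpha> by (simp add: Apery_def)
      \<comment> \<open>The sum telescopes:
        \<open>(a' - a - \<alpha>) + a + (\<alpha> - m) = a' - m\<close>.\<close>
      from numerical_semigroup_add[OF S numerical_semigroup_add[OF S that \<open>a \<in> S\<close>] this] a'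
      show False by simp
    qed
    ultimately show ?thesis using False le_iff' by (auto simp: semigroup_le_def)
  qed
qed

end
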